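(* Let $X$ be a compact metric space and $f\colon X\to X$ a homeomorphism. Fix $\varepsilon < \frac 16 \operatorname{diam}(X)$ and suppose that $f$ has specification at scale $\varepsilon$ with transition time $\tau$. Let $\varphi\colon X\to\mathbb{R}$ be a continuous potential satisfying the Bowen property at scale $\varepsilon$ with distortion constant $V$. Let \[ \Delta = \frac{\log\big(1+e^{-(V+(2\tau+1)(\sup \varphi - \inf\varphi))}\big)}{2(\tau+1)}. \] Then \[ P(\varphi) \geq P(\varphi,\varepsilon) \geq \Big( \sup_\mu \int\varphi\,d\mu\Big) + \Delta, \] where the supremum is over all $f$-invariant Borel probability measures $\mu$. In particular, every equilibrium state $\mu$ for $\varphi$ has $h_\mu(f) \geq \Delta > 0$.
   Context: Here $\varepsilon>0$. Write $S_n\varphi(x)=\sum_{k=0}^{n-1}\varphi(f^kx)$, $d_n(x,y)=\max\{d(f^kx,f^ky):0\le k<n\}$, $B_n(x,\varepsilon)=\{y: d_n(x,y)<\varepsilon\}$. A set $E\subset X$ is $(n,\varepsilon)$-separated if $d_n(x,y)\ge\varepsilon$ for all distinct $x,y\in E$. Specification at scale $\varepsilon$ with transition time $\tau\in\mathbb{N}$: for every finite collection $\{(x_j,n_j):1\le j\le k\}\subset X\times\mathbb{N}$ there is a point $x\in\bigcap_{j=1}^k f^{-(m_{j-1}+\tau)}B_{n_j}(x_j,\varepsilon)$, where $m_0=-\tau$ and $m_j=\big(\sum_{i=1}^j n_i\big)+(j-1)\tau$ for $j\ge1$. Bowen property at scale $\varepsilon$ with distortion constant $V<\infty$: $|S_n\varphi(x)-S_n\varphi(y)|\le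 V$ for all $(x,n)\in X\times\mathbb{N}$ and $y\in B_n(x,\varepsilon)$. Pressure: $P(\varphi,\varepsilon)=\limsup_{n\to\infty}\frac1n\log\sup\{\sum_{x\in E}e^{S_n\varphi(x)}: E\subset X\ (n,\varepsilon)\text{-separated}\}$ and $P(\varphi)=\lim_{\varepsilon\to0}P(\varphi,\varepsilon)$. An equilibrium state is an $f$-invariant Borel probability measure $\mu$ with $h_\mu(f)+\int\varphi\,d\mu=P(\varphi)$. *)

theory Defs
  imports "HOL-Analysis.Analysis" "HOL-Library.Disjoint_Sets"
begin

text \<open>
  The compact metric space is the whole type, as in \<^prop>\<open>compact (UNIV :: 'a::metric_space set)\<close>.
\<close>

definition birkhoff_sum :: "('a \<Rightarrow> 'a) \<Rightarrow> ('a \<Rightarrow> real) \<Rightarrow> nat \<Rightarrow> 'a \<Rightarrow> real" where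
  "birkhoff_sum f \<phi> n x = (\<Sum>k<n. \<phi> ((f ^^ k) x))"

text \<open>
  The maximum is only meaningful for \<open>n \<ge> 1\<close>. Orbit segments below therefore have positive
  length; the value at \<open>n = 0\<close> does not influence the \<open>limsup\<close> in the pressure.
\<close>

definition dyn_dist :: "('a::metric_space \<Rightarrow> 'a) \<Rightarrow> nat \<Rightarrow> 'a \<Rightarrow> 'a \<Rightarrow> real" where
  "dyn_dist f n x y = (MAX k\<in>{..<n}. dist ((f ^^ k) x) ((f ^^ k) y))"

definition dyn_ball :: "('a::metric_space \<Rightarrow> 'a) \<Rightarrow> nat \<Rightarrow> 'a \<Rightarrow> real \<Rightarrow> 'a set" where
  "dyn_ball f n x \<epsilon> = {y. dyn_dist f n x y < \<epsilon>}"

definition dyn_separated :: "('a::metric_space \<Rightarrow> 'a) \<Rightarrow> nat \<Rightarrow> real \<Rightarrow> 'a set \<Rightarrow> bool" where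
  "dyn_separated f n \<epsilon> E \<longleftrightarrow> (\<forall>x\<in>E. \<forall>y\<in>E. x \<noteq> y \<longrightarrow> dyn_dist f n x y \<ge> \<epsilon>)"

text \<open>
  \<open>glue_start \<tau> n j\<close> is the time \<open>m\<^sub>j\<^sub>-\<^sub>1 + \<tau>\<close> for \<open>j \<ge> 1\<close>, where \<open>m\<^sub>0 = - \<tau>\<close> and
  \<open>m\<^sub>j = (n\<^sub>1 + \<dots> + n\<^sub>j) + (j - 1) \<tau>\<close>: it is \<open>0\<close> for \<open>j = 1\<close>.
\<close>

definition glue_start :: "nat \<Rightarrow> (nat \<Rightarrow> nat) \<Rightarrow> nat \<Rightarrow> nat" where
  "glue_start \<tau> n j = (\<Sum>i=1..<j. n i) + (j - 1) * \<tau>"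

definition specification_at :: "('a::metric_space \<Rightarrow> 'a) \<Rightarrow> real \<Rightarrow> nat \<Rightarrow> bool" where
  "specification_at f \<epsilon> \<tau> \<longleftrightarrow>
     (\<forall>(k::nat) (x :: nat \<Rightarrow> 'a) (n :: nat \<Rightarrow> nat). (\<forall>j\<in>{1..k}. n j \<ge> 1) \<longrightarrow>
        (\<exists>z. z \<in> (\<Inter>j\<in>{1..k}. (f ^^ glue_start \<tau> n j) -` dyn_ball f (n j) (x j) \<epsilon>)))"

definition bowen_property_at ::
    "('a::metric_space \<Rightarrow> 'a) \<Rightarrow> ('a \<Rightarrow> real) \<Rightarrow> real \<Rightarrow> real \<Rightarrow> bool" where
  "bowen_property_at f \<phi> \<epsilon> V \<longleftrightarrow>
     (\<forall>x. \<forall>n\<ge>1. \<forall>y\<in>dyn_ball f n x \<epsilon>. \<bar>birkhoff_sum f \<phi> n x - birkhoff_sum f \<phi> n y\<bar> \<le> V)"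

text \<open>
  For \<open>\<epsilon> > 0\<close>, \<open>n \<ge> 1\<close>, continuous \<open>f\<close> and \<open>\<phi>\<close>, and a compact space, separated sets are finite
  with uniformly bounded cardinality, so that the sum and the real supremum below are genuine.
\<close>

definition partition_sum :: "('a::metric_space \<Rightarrow> 'a) \<Rightarrow> ('a \<Rightarrow> real) \<Rightarrow> real \<Rightarrow> nat \<Rightarrow> real" where
  "partition_sum f \<phi> \<epsilon> n = Sup {\<Sum>x\<in>E. exp (birkhoff_sum f \<phi> n x) | E. dyn_separated f n \<epsilon> E}"

definition pressure_at :: "('a::metric_space \<Rightarrow> 'a) \<Rightarrow> ('a \<Rightarrow> real) \<Rightarrow> real \<Rightarrow> ereal" where
  "pressure_at f \<phi> \<epsilon> = limsup (\<lambda>n. ereal (ln (partition_sum f \<phi> \<epsilon> n) / real n))"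

text \<open>The limit exists in the extended reals by monotonicity in \<open>\<epsilon>\<close>; it may be \<open>\<infinity>\<close>.\<close>

definition pressure :: "('a::metric_space \<Rightarrow> 'a) \<Rightarrow> ('a \<Rightarrow> real) \<Rightarrow> ereal" where
  "pressure f \<phi> = Lim (at_right 0) (\<lambda>\<epsilon>. pressure_at f \<phi> \<epsilon>)"

definition invariant_prob :: "('a::metric_space \<Rightarrow> 'a) \<Rightarrow> 'a measure \<Rightarrow> bool" where
  "invariant_prob f \<mu> \<longleftrightarrow> sets \<mu> = sets borel \<and> emeasure \<mu> UNIV = 1 \<and>
     (\<forall>A\<in>sets borel. emeasure \<mu> (f -` A) = emeasure \<mu> A)"

definition finite_borel_partition :: "'a::metric_space set set \<Rightarrow> bool" where
  "finite_borel_partition P \<longleftrightarrow> finite P \<and> P \<subseteq> sets borel \<and> partition_on UNIV P"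

text \<open>The convention \<open>0 log 0 = 0\<close> holds because of the factor \<open>0\<close>.\<close>

definition static_entropy :: "'a measure \<Rightarrow> 'a set set \<Rightarrow> real" where
  "static_entropy \<mu> P = - (\<Sum>A\<in>P. measure \<mu> A * ln (measure \<mu> A))"

text \<open>The common refinement of the partitions \<open>f\<^sup>-\<^sup>k P\<close> for \<open>0 \<le> k < n\<close>.\<close>

definition dyn_refinement :: "('a \<Rightarrow> 'a) \<Rightarrow> 'a set set \<Rightarrow> nat \<Rightarrow> 'a set set" where
  "dyn_refinement f P n = {\<Inter>k<n. (f ^^ k) -` A k | A. \<forall>k<n. A k \<in> P} - {{}}"

text \<open>
  Kolmogorov--Sinai entropy. For invariant \<open>\<mu>\<close> the limit exists by subadditivity.
\<close>

definition partition_entropy :: "'a measure \<Rightarrow> ('a \<Rightarrow> 'a) \<Rightarrow> 'a set set \<Rightarrow> ereal" where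
  "partition_entropy \<mu> f P = lim (\<lambda>n. ereal (static_entropy \<mu> (dyn_refinement f P n) / real n))"

definition metric_entropy :: "'a::metric_space measure \<Rightarrow> ('a \<Rightarrow> 'a) \<Rightarrow> ereal" where
  "metric_entropy \<mu> f = (SUP P\<in>{P. finite_borel_partition P}. partition_entropy \<mu> f P)"

definition equilibrium_state ::
    "('a::metric_space \<Rightarrow> 'a) \<Rightarrow> ('a \<Rightarrow> real) \<Rightarrow> 'a measure \<Rightarrow> bool" where
  "equilibrium_state f \<phi> \<mu> \<longleftrightarrow> invariant_prob f \<mu> \<and>
     metric_entropy \<mu> f + ereal (integral\<^sup>L \<mu> \<phi>) = pressure f \<phi>"

end

theory Submission
  imports Defs
begin

text \<open>
  Fix an invariant probability \<open>\<mu>\<close> and a length \<open>N = M (2 \<tau> + 2) + 1\<close>. Since the integral of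
  \<open>S\<^sub>N \<phi>\<close> is \<open>N \<integral>\<phi> d\<mu>\<close>, some orbit segment of length \<open>N\<close>, starting at \<open>x\<close> say, has a Birkhoff sum
  of at least this size (\<open>ex_birkhoff_sum_ge_integral\<close>). Positive entropy is created around this
  single segment. Cut it into one initial step and \<open>M\<close> blocks of length \<open>2 \<tau> + 2\<close>. In each block
  there is a binary choice: follow the orbit of \<open>x\<close>, or spend \<open>\<tau>\<close> steps on leaving it, visit for one
  step a point at distance more than \<open>3 \<epsilon>\<close> from the orbit, and spend \<open>\<tau>\<close> steps on coming back.
  Such a far point exists because the diameter exceeds \<open>6 \<epsilon>\<close>. Specification
  realises every one of the \<open>2\<^sup>M\<close> itineraries by a true orbit up to an error \<open>\<epsilon>\<close>.

  Two different itineraries disagree in some block; there one orbit is \<open>\<epsilon>\<close>-close to the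
  orbit of \<open>x\<close> and the other is \<open>\<epsilon>\<close>-close to the far point, so they are
  separated by \<open>3 \<epsilon> - 2 \<epsilon> = \<epsilon>\<close> (\<open>shadows_itinerary_at_visit\<close>). An excursion costs
  \<open>(2 \<tau> + 1) (sup \<phi> - inf \<phi>)\<close> for the time away, and one further distortion constant \<open>V\<close> because it
  cuts a followed stretch in two; so with \<open>c = V + (2 \<tau> + 1) (sup \<phi> - inf \<phi>)\<close> an orbit with \<open>r\<close>
  excursions has Birkhoff sum at least \<open>S\<^sub>N \<phi> x - V - r c\<close> (\<open>birkhoff_sum_itinerary_ge\<close>).
  Summing \<open>exp (- r c)\<close> over all itineraries gives \<open>(1 + exp (- c)) ^ M\<close>, hence
  \<open>partition_sum f \<phi> \<epsilon> N \<ge> exp (N \<integral>\<phi> d\<mu> - V) * (1 + exp (- c)) ^ M\<close>, and dividing the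
  logarithm by \<open>N\<close> and letting \<open>M\<close> tend to infinity gives the bound \<open>\<integral>\<phi> d\<mu> + \<Delta>\<close> for the pressure.

  The comparison of \<open>P(\<phi>)\<close> with \<open>P(\<phi>, \<epsilon>)\<close> is monotonicity: a set that is separated at scale \<open>\<epsilon>\<close>
  is separated at every smaller scale, so the limit at \<open>0\<close> is a supremum
  (\<open>pressure_at_le_pressure\<close>). The statement on equilibrium states follows by cancelling the finite integral in
  \<open>h\<^sub>\<mu>(f) + \<integral>\<phi> d\<mu> = P(\<phi>) \<ge> \<integral>\<phi> d\<mu> + \<Delta>\<close>.
\<close>

section \<open>Birkhoff sums and Bowen balls\<close>

lemma birkhoff_sum_add:
  "birkhoff_sum f \<phi> (m + n) x = birkhoff_sum f \<phi> m x + birkhoff_sum f \<phi> n ((f ^^ m) x)"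
proof (induction n)
  case (Suc n)
  have "(f ^^ (m + n)) x = (f ^^ n) ((f ^^ m) x)"
    by (metis add.commute comp_apply funpow_add)
  with Suc show ?case by (simp add: birkhoff_sum_def)
qed (simp add: birkhoff_sum_def)

lemma birkhoff_sum_diff_le:
  assumes "\<And>x y. \<phi> x - \<phi> y \<le> D"
  shows "birkhoff_sum f \<phi> n x - birkhoff_sum f \<phi> n y \<le> real n * D"
proof -
  have "birkhoff_sum f \<phi> n x - birkhoff_sum f \<phi> n y
      = (\<Sum>k<n. \<phi> ((f ^^ k) x) - \<phi> ((f ^^ k) y))"
    by (simp add: birkhoff_sum_def sum_subtractf)
  also have "\<dots> \<le> (\<Sum>k<n. D)" by (intro sum_mono assms)
  finally show ?thesis by simp
qed

lemma dyn_dist_less_iff: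
  assumes "n \<ge> 1"
  shows "dyn_dist f n x y < e \<longleftrightarrow> (\<forall>k<n. dist ((f ^^ k) x) ((f ^^ k) y) < e)"
proof -
  have "{..<n} \<noteq> {}" using assms by (auto simp: lessThan_empty_iff)
  then show ?thesis unfolding dyn_dist_def by (subst Max_less_iff) auto
qed

lemma dist_le_dyn_dist:
  "k < n \<Longrightarrow> dist ((f ^^ k) x) ((f ^^ k) y) \<le> dyn_dist f n x y"
  unfolding dyn_dist_def by (rule Max_ge) auto

section \<open>Partition sums and monotonicity of the pressure in the scale\<close>

lemma continuous_on_funpow:
  fixes f :: "'a::topological_space \<Rightarrow> 'a"
  assumes "continuous_on UNIV f"
  shows "continuous_on UNIV (f ^^ k)"
proof (induction k)
  case (Suc k)
  have "continuous_on UNIV (\<lambda>x. f ((f ^^ k) x))"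
    by (rule continuous_on_compose2[OF assms Suc]) simp
  then show ?case by (simp add: o_def)
qed (simp add: id_def)

lemma continuous_on_birkhoff_sum:
  fixes f :: "'a::topological_space \<Rightarrow> 'a"
  assumes "continuous_on UNIV f" "continuous_on UNIV \<phi>"
  shows "continuous_on UNIV (birkhoff_sum f \<phi> n)"
proof -
  have "continuous_on UNIV (\<lambda>x. \<Sum>k<n. \<phi> ((f ^^ k) x))"
    by (intro continuous_on_sum continuous_on_compose2[OF assms(2) continuous_on_funpow[OF assms(1)]])
       simp
  then show ?thesis by (simp add: birkhoff_sum_def[abs_def])
qed

text \<open>
  By uniform continuity of the first \<open>n\<close> iterates, a separated set has at most one point in each
  ball of some small radius, and finitely many such balls cover the space.
\<close>

lemma dyn_separated_card_bound:
  fixes f :: "'a::metric_space \<Rightarrow> 'a"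
  assumes "compact (UNIV :: 'a set)" "continuous_on UNIV f" "e > 0" "n \<ge> 1"
  obtains K where "\<And>E. dyn_separated f n e E \<Longrightarrow> finite E \<and> card E \<le> K"
proof -
  have "\<exists>d>0. \<forall>x y. dist x y < d \<longrightarrow> dist ((f ^^ k) x) ((f ^^ k) y) < e" for k
  proof -
    have "uniformly_continuous_on UNIV (f ^^ k)"
      by (rule compact_uniformly_continuous[OF continuous_on_funpow[OF assms(2)] assms(1)])
    then show ?thesis
      unfolding uniformly_continuous_on_def using \<open>e > 0\<close> by (metis UNIV_I dist_commute)
  qed
  then obtain d where d: "\<And>k. d k > 0"
      "\<And>k x y. dist x y < d k \<Longrightarrow> dist ((f ^^ k) x) ((f ^^ k) y) < e"
    by metis
  define r where "r = Min (d ` {..<n}) / 2"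
  have ne: "d ` {..<n} \<noteq> {}" using assms(4) by (auto simp: lessThan_empty_iff)
  have "r > 0" unfolding r_def using d(1) ne by simp
  have r_le: "2 * r \<le> d k" if "k < n" for k
    unfolding r_def using that by simp
  obtain C :: "'a set" where C: "finite C" "UNIV \<subseteq> (\<Union>c\<in>C. ball c r)"
    using assms(1) \<open>r > 0\<close> unfolding compact_eq_totally_bounded by meson
  have "finite E \<and> card E \<le> card C" if E: "dyn_separated f n e E" for E
  proof -
    obtain h where h: "\<And>x. h x \<in> C" "\<And>x. dist (h x) x < r"
      using C(2) by (metis UNIV_I UN_E mem_ball subsetD)
    have "inj_on h E"
    proof (rule inj_onI, rule ccontr)
      fix x y assume xy: "x \<in> E" "y \<in> E" "h x = h y" "x \<noteq> y"
      have "dist x y < 2 * r"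
        using h(2)[of x] h(2)[of y] xy(3) dist_triangle3[of x y "h x"] by simp
      then have "dyn_dist f n x y < e"
        unfolding dyn_dist_less_iff[OF assms(4)] using d(2) r_le by force
      then show False using E xy unfolding dyn_separated_def by force
    qed
    moreover have "h ` E \<subseteq> C" using h(1) by auto
    ultimately show ?thesis
      using C(1) by (meson card_inj_on_le inj_on_finite)
  qed
  then show ?thesis by (rule that)
qed

lemma partition_sum_set_bdd_above:
  fixes f :: "'a::metric_space \<Rightarrow> 'a"
  assumes "compact (UNIV :: 'a set)" "continuous_on UNIV f" "continuous_on UNIV \<phi>" "e > 0" "n \<ge> 1"
  shows "bdd_above {\<Sum>x\<in>E. exp (birkhoff_sum f \<phi> n x) | E. dyn_separated f n e E}"
proof -
  obtain K where K: "\<And>E. dyn_separated f n e E \<Longrightarrow> finite E \<and> card E \<le> K"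
    using dyn_separated_card_bound[OF assms(1,2,4,5)] by blast
  obtain x0 where x0: "\<And>x. birkhoff_sum f \<phi> n x \<le> birkhoff_sum f \<phi> n x0"
    using continuous_attains_sup[OF assms(1) UNIV_not_empty
        continuous_on_birkhoff_sum[OF assms(2,3)]] by blast
  show ?thesis
  proof (rule bdd_aboveI)
    fix s assume "s \<in> {\<Sum>x\<in>E. exp (birkhoff_sum f \<phi> n x) | E. dyn_separated f n e E}"
    then obtain E where E: "dyn_separated f n e E" "s = (\<Sum>x\<in>E. exp (birkhoff_sum f \<phi> n x))"
      by auto
    have "s \<le> of_nat (card E) * exp (birkhoff_sum f \<phi> n x0)"
      unfolding E(2) by (rule sum_bounded_above) (simp add: x0)
    also have "\<dots> \<le> real K * exp (birkhoff_sum f \<phi> n x0)"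
      using K[OF E(1)] by (intro mult_right_mono) auto
    finally show "s \<le> real K * exp (birkhoff_sum f \<phi> n x0)" .
  qed
qed

lemma partition_sum_ge:
  fixes f :: "'a::metric_space \<Rightarrow> 'a"
  assumes "compact (UNIV :: 'a set)" "continuous_on UNIV f" "continuous_on UNIV \<phi>" "e > 0" "n \<ge> 1"
    and "dyn_separated f n e E"
  shows "(\<Sum>x\<in>E. exp (birkhoff_sum f \<phi> n x)) \<le> partition_sum f \<phi> e n"
  unfolding partition_sum_def
  by (rule cSup_upper[OF _ partition_sum_set_bdd_above[OF assms(1-5)]]) (use assms(6) in blast)

lemma partition_sum_pos:
  fixes f :: "'a::metric_space \<Rightarrow> 'a"
  assumes "compact (UNIV :: 'a set)" "continuous_on UNIV f" "continuous_on UNIV \<phi>" "e > 0" "n \<ge> 1"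
  shows "partition_sum f \<phi> e n > 0"
proof -
  have "dyn_separated f n e {undefined}" by (simp add: dyn_separated_def)
  from partition_sum_ge[OF assms this] show ?thesis
    by (simp add: less_le_trans[OF exp_gt_zero])
qed

lemma partition_sum_antimono:
  fixes f :: "'a::metric_space \<Rightarrow> 'a"
  assumes "compact (UNIV :: 'a set)" "continuous_on UNIV f" "continuous_on UNIV \<phi>"
    and "0 < e'" "e' \<le> e" "n \<ge> 1"
  shows "partition_sum f \<phi> e n \<le> partition_sum f \<phi> e' n"
  unfolding partition_sum_def
proof (rule cSup_subset_mono)
  have "dyn_separated f n e {}" by (simp add: dyn_separated_def)
  then show "{\<Sum>x\<in>E. exp (birkhoff_sum f \<phi> n x) | E. dyn_separated f n e E} \<noteq> {}" by blast
  have "dyn_separated f n e' E" if "dyn_separated f n e E" for E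
    using that assms(5) unfolding dyn_separated_def by force
  then show "{\<Sum>x\<in>E. exp (birkhoff_sum f \<phi> n x) | E. dyn_separated f n e E}
      \<subseteq> {\<Sum>x\<in>E. exp (birkhoff_sum f \<phi> n x) | E. dyn_separated f n e' E}" by blast
qed (rule partition_sum_set_bdd_above[OF assms(1-4,6)])

lemma pressure_at_antimono:
  fixes f :: "'a::metric_space \<Rightarrow> 'a"
  assumes "compact (UNIV :: 'a set)" "continuous_on UNIV f" "continuous_on UNIV \<phi>"
    and "0 < e'" "e' \<le> e"
  shows "pressure_at f \<phi> e \<le> pressure_at f \<phi> e'"
  unfolding pressure_at_def
proof (rule Limsup_mono, rule eventually_sequentiallyI[of 1])
  fix n :: nat assume "1 \<le> n"
  then have "ln (partition_sum f \<phi> e n) \<le> ln (partition_sum f \<phi> e' n)"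
    using partition_sum_antimono[OF assms] partition_sum_pos[OF assms(1-3)] assms(4,5)
    by (subst ln_le_cancel_iff) auto
  then show "ereal (ln (partition_sum f \<phi> e n) / real n)
      \<le> ereal (ln (partition_sum f \<phi> e' n) / real n)"
    by (simp add: divide_right_mono)
qed

lemma antimono_tendsto_at_right_SUP:
  fixes g :: "real \<Rightarrow> 'b::{complete_linorder, linorder_topology}"
  assumes mono: "\<And>x y. a < x \<Longrightarrow> x \<le> y \<Longrightarrow> g y \<le> g x"
  shows "(g \<longlongrightarrow> (SUP x\<in>{a<..}. g x)) (at_right a)"
proof (rule order_tendstoI)
  fix c assume "c < (SUP x\<in>{a<..}. g x)"
  then obtain y where y: "a < y" "c < g y" by (auto simp: less_SUP_iff)
  have "\<forall>\<^sub>F x in at_right a. x \<in> {a<..<y}"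
    by (rule eventually_at_right_less[of a, THEN eventually_elim2,
          OF eventually_at_rightI[of a y "\<lambda>x. x < y"]]) (use y in auto)
  then show "\<forall>\<^sub>F x in at_right a. c < g x"
    by eventually_elim (use y mono in \<open>force intro: less_le_trans\<close>)
next
  fix c assume c: "(SUP x\<in>{a<..}. g x) < c"
  have "g x < c" if "a < x" for x
    by (rule le_less_trans[OF SUP_upper c]) (use that in simp)
  then show "\<forall>\<^sub>F x in at_right a. g x < c"
    by (intro eventually_at_rightI[of a "a + 1"]) auto
qed

lemma pressure_at_le_pressure:
  fixes f :: "'a::metric_space \<Rightarrow> 'a"
  assumes "compact (UNIV :: 'a set)" "continuous_on UNIV f" "continuous_on UNIV \<phi>" "0 < e"
  shows "pressure_at f \<phi> e \<le> pressure f \<phi>"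
proof -
  have "((\<lambda>e. pressure_at f \<phi> e) \<longlongrightarrow> (SUP e\<in>{0<..}. pressure_at f \<phi> e)) (at_right 0)"
    by (rule antimono_tendsto_at_right_SUP) (rule pressure_at_antimono[OF assms(1-3)])
  then have "pressure f \<phi> = (SUP e\<in>{0<..}. pressure_at f \<phi> e)"
    unfolding pressure_def by (intro tendsto_Lim) simp_all
  then show ?thesis using \<open>0 < e\<close> by (simp add: SUP_upper)
qed

section \<open>Invariant measures and orbits with large Birkhoff sums\<close>

lemma integral_comp_invariant:
  fixes \<phi> :: "'a::metric_space \<Rightarrow> real"
  assumes inv: "invariant_prob f \<mu>" and f: "f \<in> borel_measurable borel"
    and g: "g \<in> borel_measurable borel"
  shows "integral\<^sup>L \<mu> (\<lambda>x. g (f x)) = (integral\<^sup>L \<mu> g :: real)"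
proof -
  have sets: "sets \<mu> = sets borel" using inv by (simp add: invariant_prob_def)
  then have space: "space \<mu> = UNIV" using sets_eq_imp_space_eq by fastforce
  have fm: "f \<in> measurable \<mu> \<mu>" using f by (simp add: measurable_cong_sets[OF sets sets])
  have gm: "g \<in> borel_measurable \<mu>" using g by (simp add: measurable_cong_sets[OF sets refl])
  have "distr \<mu> \<mu> f = \<mu>"
  proof (rule measure_eqI)
    fix A assume "A \<in> sets (distr \<mu> \<mu> f)"
    then show "emeasure (distr \<mu> \<mu> f) A = emeasure \<mu> A"
      using inv fm by (simp add: emeasure_distr space sets invariant_prob_def)
  qed simp
  then show ?thesis using integral_distr[OF fm gm] by simp
qed

lemma ex_birkhoff_sum_ge_integral:
  fixes f :: "'a::metric_space \<Rightarrow> 'a"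
  assumes X: "compact (UNIV :: 'a set)" and f: "continuous_on UNIV f"
    and \<phi>: "continuous_on UNIV \<phi>" and inv: "invariant_prob f \<mu>"
  shows "\<exists>x. birkhoff_sum f \<phi> n x \<ge> real n * integral\<^sup>L \<mu> \<phi>"
proof -
  have sets: "sets \<mu> = sets borel" and one: "emeasure \<mu> UNIV = 1"
    using inv by (simp_all add: invariant_prob_def)
  then have space: "space \<mu> = UNIV" using sets_eq_imp_space_eq by fastforce
  interpret finite_measure \<mu> by (rule finite_measureI) (simp add: space one)
  have fk: "continuous_on UNIV (\<lambda>x. \<phi> ((f ^^ k) x))" for k
    by (rule continuous_on_compose2[OF \<phi> continuous_on_funpow[OF f]]) simp
  have int_cont: "integrable \<mu> g" if g: "continuous_on UNIV g" for g :: "'a \<Rightarrow> real"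
  proof -
    have "bounded (range g)" by (rule compact_imp_bounded[OF compact_continuous_image[OF g X]])
    then obtain B where "\<And>x. norm (g x) \<le> B" unfolding bounded_iff by auto
    moreover have "g \<in> borel_measurable \<mu>"
      using borel_measurable_continuous_onI[OF g] by (simp add: measurable_cong_sets[OF sets refl])
    ultimately show ?thesis by (intro integrable_const_bound[of _ B]) auto
  qed
  have step: "integral\<^sup>L \<mu> (\<lambda>x. \<phi> ((f ^^ k) x)) = integral\<^sup>L \<mu> \<phi>" for k
  proof (induction k)
    case (Suc k)
    have "integral\<^sup>L \<mu> (\<lambda>x. (\<lambda>x. \<phi> ((f ^^ k) x)) (f x)) = integral\<^sup>L \<mu> (\<lambda>x. \<phi> ((f ^^ k) x))"
      by (rule integral_comp_invariant[OF inv borel_measurable_continuous_onI[OF f]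
            borel_measurable_continuous_onI[OF fk]])
    then show ?case using Suc by (simp only: funpow_Suc_right o_apply)
  qed simp
  obtain x0 where x0: "\<And>x. birkhoff_sum f \<phi> n x \<le> birkhoff_sum f \<phi> n x0"
    using continuous_attains_sup[OF X UNIV_not_empty continuous_on_birkhoff_sum[OF f \<phi>]] by blast
  have "real n * integral\<^sup>L \<mu> \<phi> = integral\<^sup>L \<mu> (birkhoff_sum f \<phi> n)"
    unfolding birkhoff_sum_def[abs_def] by (simp add: int_cont[OF fk] step)
  also have "\<dots> \<le> integral\<^sup>L \<mu> (\<lambda>x. birkhoff_sum f \<phi> n x0)"
    by (intro integral_mono int_cont continuous_on_birkhoff_sum[OF f \<phi>] x0) simp_all
  also have "\<dots> = birkhoff_sum f \<phi> n x0" by (simp add: space measure_def one)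
  finally show ?thesis by blast
qed

section \<open>Shadowing a list of orbit segments\<close>

text \<open>
  The gluing condition of specification, read along the list of segments: shadow the first one, wait
  for \<open>\<tau>\<close> steps, and go on from there. This form makes induction over itineraries
  possible without computing the starting times.
\<close>

fun shadows :: "('a::metric_space \<Rightarrow> 'a) \<Rightarrow> real \<Rightarrow> nat \<Rightarrow> 'a \<Rightarrow> ('a \<times> nat) list \<Rightarrow> bool" where
  "shadows f \<epsilon> \<tau> z [] \<longleftrightarrow> True"
| "shadows f \<epsilon> \<tau> z ((x, n) # L) \<longleftrightarrow> z \<in> dyn_ball f n x \<epsilon> \<and> shadows f \<epsilon> \<tau> ((f ^^ (n + \<tau>)) z) L"

lemma shadowsI:
  assumes "\<And>i. i < length L \<Longrightarrow>
    (f ^^ (\<Sum>j<i. snd (L ! j) + \<tau>)) z \<in> dyn_ball f (snd (L ! i)) (fst (L ! i)) \<epsilon>"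
  shows "shadows f \<epsilon> \<tau> z L"
  using assms
proof (induction L arbitrary: z)
  case (Cons a L)
  obtain x n where a: "a = (x, n)" by force
  have "z \<in> dyn_ball f n x \<epsilon>" using Cons.prems[of 0] by (simp add: a)
  moreover have "shadows f \<epsilon> \<tau> ((f ^^ (n + \<tau>)) z) L"
  proof (rule Cons.IH)
    fix i assume i: "i < length L"
    have "(\<Sum>j<Suc i. snd ((a # L) ! j) + \<tau>) = (\<Sum>j<i. snd (L ! j) + \<tau>) + (n + \<tau>)"
      by (simp add: a sum.lessThan_Suc_shift del: sum.lessThan_Suc)
    then show "(f ^^ (\<Sum>j<i. snd (L ! j) + \<tau>)) ((f ^^ (n + \<tau>)) z)
        \<in> dyn_ball f (snd (L ! i)) (fst (L ! i)) \<epsilon>"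
      using Cons.prems[of "Suc i"] i by (simp add: funpow_add del: sum.lessThan_Suc)
  qed
  ultimately show ?case by (simp add: a)
qed simp

lemma specification_shadows:
  assumes "specification_at f \<epsilon> \<tau>" and "\<forall>(x, n)\<in>set L. n \<ge> 1"
  shows "\<exists>z. shadows f \<epsilon> \<tau> z L"
proof -
  define x where "x j = fst (L ! (j - 1))" for j
  define n where "n j = snd (L ! (j - 1))" for j
  have "\<forall>j\<in>{1..length L}. n j \<ge> 1"
  proof
    fix j assume "j \<in> {1..length L}"
    then have "L ! (j - 1) \<in> set L" by auto
    with assms(2) show "n j \<ge> 1" unfolding n_def by (cases "L ! (j - 1)") auto
  qed
  then obtain z where z: "z \<in> (\<Inter>j\<in>{1..length L}. (f ^^ glue_start \<tau> n j) -` dyn_ball f (n j) (x j) \<epsilon>)"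
    using assms(1) unfolding specification_at_def by blast
  have glue: "glue_start \<tau> n (Suc i) = (\<Sum>j<i. snd (L ! j) + \<tau>)" for i
    by (induction i) (simp_all add: glue_start_def n_def)
  have "shadows f \<epsilon> \<tau> z L"
  proof (rule shadowsI)
    fix i assume "i < length L"
    then have "Suc i \<in> {1..length L}" by auto
    with z have "(f ^^ glue_start \<tau> n (Suc i)) z \<in> dyn_ball f (n (Suc i)) (x (Suc i)) \<epsilon>" by blast
    then show "(f ^^ (\<Sum>j<i. snd (L ! j) + \<tau>)) z \<in> dyn_ball f (snd (L ! i)) (fst (L ! i)) \<epsilon>"
      by (simp add: glue[symmetric]) (simp add: n_def x_def)
  qed
  then show ?thesis by blast
qed

section \<open>Itineraries with excursions\<close>

text \<open>
  The list of segments for a word of choices, one letter per block; \<open>True\<close> means an excursion to the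
  point that \<open>q\<close> assigns to the current orbit point. The stretch that is being followed starts at \<open>p\<close>
  and has length \<open>n\<close> so far; it is extended by a whole block at every \<open>False\<close>, so that
  consecutive blocks without excursion form a single segment and cost the distortion constant
  only once. An excursion uses up \<open>2 \<tau> + 1\<close> steps of its block of length \<open>2 \<tau> + 2\<close>; the one
  remaining step is the \<open>1\<close> in the recursive call, and it keeps the next followed stretch nonempty.
\<close>

fun itinerary :: "('a \<Rightarrow> 'a) \<Rightarrow> nat \<Rightarrow> ('a \<Rightarrow> 'a) \<Rightarrow> 'a \<Rightarrow> nat \<Rightarrow> bool list \<Rightarrow> ('a \<times> nat) list" where
  "itinerary f \<tau> q p n [] = [(p, n)]"
| "itinerary f \<tau> q p n (False # w) = itinerary f \<tau> q p (n + (2 * \<tau> + 2)) w"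
| "itinerary f \<tau> q p n (True # w) =
     (p, n) # (q ((f ^^ (n + \<tau>)) p), 1) # itinerary f \<tau> q ((f ^^ (n + (2 * \<tau> + 1))) p) 1 w"

lemma funpow_excursion: "(f ^^ (1 + \<tau>)) ((f ^^ (n + \<tau>)) z) = (f ^^ (n + (2 * \<tau> + 1))) z"
proof -
  have "n + (2 * \<tau> + 1) = (1 + \<tau>) + (n + \<tau>)" by simp
  then show ?thesis by (simp only: funpow_add o_apply)
qed

lemma itinerary_lengths_pos:
  "n \<ge> 1 \<Longrightarrow> \<forall>(x, m)\<in>set (itinerary f \<tau> q p n w). m \<ge> 1"
  by (induction f \<tau> q p n w rule: itinerary.induct) auto

lemma shadows_itinerary_start:
  assumes "shadows f \<epsilon> \<tau> z (itinerary f \<tau> q p n w)" "k < n"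
  shows "dist ((f ^^ k) p) ((f ^^ k) z) < \<epsilon>"
  using assms
  by (induction f \<tau> q p n w rule: itinerary.induct)
     (auto simp: dyn_ball_def intro: le_less_trans[OF dist_le_dyn_dist])

text \<open>
  In the block with index \<open>i\<close> the excursion, if there is one, reaches its target at time
  \<open>n + i (2 \<tau> + 2) + \<tau>\<close>; this is the time at which different itineraries can be told apart.
\<close>

lemma shadows_itinerary_at_visit:
  assumes "shadows f \<epsilon> \<tau> z (itinerary f \<tau> q p n w)" "i < length w"
    and "t = n + i * (2 * \<tau> + 2) + \<tau>"
  shows "dist (if w ! i then q ((f ^^ t) p) else (f ^^ t) p) ((f ^^ t) z) < \<epsilon>"
  using assms
proof (induction f \<tau> q p n w arbitrary: z i t rule: itinerary.induct)
  case (2 f \<tau> q p n w)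
  show ?case
  proof (cases i)
    case 0
    then show ?thesis using shadows_itinerary_start[of f \<epsilon> \<tau> z q p "n + (2 * \<tau> + 2)" w t] 2 by simp
  next
    case (Suc j)
    then show ?thesis using 2(1)[of z j t] 2(2-) by (simp add: algebra_simps)
  qed
next
  case (3 f \<tau> q p n w)
  let ?p = "(f ^^ (n + (2 * \<tau> + 1))) p" and ?z = "(f ^^ (n + (2 * \<tau> + 1))) z"
  have "(f ^^ (1 + \<tau>)) ((f ^^ (n + \<tau>)) z) = ?z"
    by (rule funpow_excursion)
  with 3(2) have visit: "(f ^^ (n + \<tau>)) z \<in> dyn_ball f 1 (q ((f ^^ (n + \<tau>)) p)) \<epsilon>"
    and rest: "shadows f \<epsilon> \<tau> ?z (itinerary f \<tau> q ?p 1 w)"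
    by simp_all
  show ?case
  proof (cases i)
    case 0
    then show ?thesis using visit 3(4) by (simp add: dyn_ball_def dyn_dist_less_iff)
  next
    case (Suc j)
    define s where "s = 1 + j * (2 * \<tau> + 2) + \<tau>"
    have t: "t = s + (n + (2 * \<tau> + 1))" using 3(4) Suc by (simp add: s_def)
    have "dist (if w ! j then q ((f ^^ s) ?p) else (f ^^ s) ?p) ((f ^^ s) ?z) < \<epsilon>"
      using 3(1)[OF rest _ s_def] 3(3) Suc by simp
    then show ?thesis using Suc by (simp only: t funpow_add o_apply nth_Cons_Suc)
  qed
qed simp

text \<open>
  Each excursion costs at most \<open>(2 \<tau> + 1) D\<close> while the orbit is away from that of \<open>p\<close>, and it starts
  a new followed stretch, which costs at most another \<open>V\<close>. The additional \<open>V\<close> is for the first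
  stretch.
\<close>

lemma birkhoff_sum_itinerary_ge:
  assumes bowen: "bowen_property_at f \<phi> \<epsilon> V" and D: "\<And>x y. \<phi> x - \<phi> y \<le> D"
    and "shadows f \<epsilon> \<tau> z (itinerary f \<tau> q p n w)" "n \<ge> 1"
    and "N = n + length w * (2 * \<tau> + 2)"
  shows "birkhoff_sum f \<phi> N z
    \<ge> birkhoff_sum f \<phi> N p - V - real (count_list w True) * (V + (2 * real \<tau> + 1) * D)"
  using bowen assms(3-)
proof (induction f \<tau> q p n w arbitrary: z N rule: itinerary.induct)
  case (1 f \<tau> q p n)
  then have "\<bar>birkhoff_sum f \<phi> n p - birkhoff_sum f \<phi> n z\<bar> \<le> V"
    unfolding bowen_property_at_def by simp
  then show ?case using 1 by simp
next
  case (2 f \<tau> q p n w)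
  then show ?case using 2(1)[of z N] by (simp add: algebra_simps)
next
  case (3 f \<tau> q p n w)
  let ?p = "(f ^^ (n + (2 * \<tau> + 1))) p" and ?z = "(f ^^ (n + (2 * \<tau> + 1))) z"
  define M where "M = 1 + length w * (2 * \<tau> + 2)"
  have N: "N = n + (2 * \<tau> + 1) + M" using 3(5) by (simp add: M_def)
  have "(f ^^ (1 + \<tau>)) ((f ^^ (n + \<tau>)) z) = ?z"
    by (rule funpow_excursion)
  with 3(3) have first: "z \<in> dyn_ball f n p \<epsilon>"
    and rest: "shadows f \<epsilon> \<tau> ?z (itinerary f \<tau> q ?p 1 w)"
    by simp_all
  have "birkhoff_sum f \<phi> n p - birkhoff_sum f \<phi> n z \<le> V"
    using 3(2) first \<open>n \<ge> 1\<close> unfolding bowen_property_at_def by (meson abs_le_D1)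
  moreover have "birkhoff_sum f \<phi> (2 * \<tau> + 1) ((f ^^ n) p)
      - birkhoff_sum f \<phi> (2 * \<tau> + 1) ((f ^^ n) z) \<le> (2 * real \<tau> + 1) * D"
    using birkhoff_sum_diff_le[of \<phi> D f "2 * \<tau> + 1" "(f ^^ n) p" "(f ^^ n) z", OF D]
    by (simp add: algebra_simps)
  moreover have "birkhoff_sum f \<phi> M ?z
      \<ge> birkhoff_sum f \<phi> M ?p - V - real (count_list w True) * (V + (2 * real \<tau> + 1) * D)"
    using 3(1)[OF 3(2) rest _ M_def] by simp
  ultimately show ?case
    unfolding N birkhoff_sum_add by (simp add: algebra_simps)
qed

lemma sum_exp_count_words:
  "(\<Sum>w | length w = M. exp (- real (count_list w True) * c)) = (1 + exp (- c)) ^ M"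
proof (induction M)
  case (Suc M)
  let ?W = "{w :: bool list. length w = M}"
  have fin: "finite ?W" using finite_lists_length_eq[of "UNIV :: bool set" M] by simp
  have "{w :: bool list. length w = Suc M} = (#) True ` ?W \<union> (#) False ` ?W"
    by (auto simp: length_Suc_conv image_iff)
  moreover have "(#) True ` ?W \<inter> (#) False ` ?W = {}" by auto
  ultimately have "(\<Sum>w | length w = Suc M. exp (- real (count_list w True) * c))
      = (\<Sum>w\<in>?W. exp (- real (count_list (True # w) True) * c))
        + (\<Sum>w\<in>?W. exp (- real (count_list (False # w) True) * c))"
    using fin by (simp only: sum.union_disjoint finite_imageI)
      (simp add: sum.reindex algebra_simps)
  also have "(\<Sum>w\<in>?W. exp (- real (count_list (True # w) True) * c))
      = exp (- c) * (\<Sum>w\<in>?W. exp (- real (count_list w True) * c))"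
    unfolding sum_distrib_left exp_add[symmetric]
    by (intro sum.cong refl) (simp add: exp_add[symmetric] algebra_simps)
  finally show ?case using Suc by (simp add: distrib_right)
qed simp

section \<open>The pressure gap\<close>

lemma ex_far_point:
  fixes p :: "'a::metric_space"
  assumes "bounded (UNIV :: 'a set)" "0 < e" "e < diameter (UNIV :: 'a set) / 2"
  shows "\<exists>y. dist p y > e"
proof -
  obtain x y :: 'a where "2 * e < dist x y"
    using diameter_lower_bounded[OF assms(1), of "2 * e"] assms(2,3) by auto
  then have "dist p x > e \<or> dist p y > e"
    using dist_triangle3[of x y p] by linarith
  then show ?thesis by blast
qed

text \<open>
  The itineraries start with one step along the orbit of \<open>x\<close>, which makes the first followed stretch
  nonempty even if an excursion comes first.
\<close>

lemma partition_sum_ge_excursions: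
  fixes f :: "'a::metric_space \<Rightarrow> 'a"
  assumes X: "compact (UNIV :: 'a set)" and f: "continuous_on UNIV f" and \<phi>: "continuous_on UNIV \<phi>"
    and eps: "0 < \<epsilon>" "\<epsilon> < 1 / 6 * diameter (UNIV :: 'a set)"
    and spec: "specification_at f \<epsilon> \<tau>" and bowen: "bowen_property_at f \<phi> \<epsilon> V"
    and D: "\<And>x y. \<phi> x - \<phi> y \<le> D"
    and c: "c = V + (2 * real \<tau> + 1) * D" and N: "N = 1 + M * (2 * \<tau> + 2)"
  shows "exp (birkhoff_sum f \<phi> N x - V) * (1 + exp (- c)) ^ M \<le> partition_sum f \<phi> \<epsilon> N"
proof -
  have "\<exists>y. dist p y > 3 * \<epsilon>" for p :: 'a
    by (rule ex_far_point[OF compact_imp_bounded[OF X]]) (use eps in simp_all)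
  then obtain q where q: "\<And>p :: 'a. dist p (q p) > 3 * \<epsilon>" by metis
  obtain z where z: "\<And>w. shadows f \<epsilon> \<tau> (z w) (itinerary f \<tau> q x 1 w)"
    using specification_shadows[OF spec itinerary_lengths_pos] by (metis order_refl)
  let ?W = "{w :: bool list. length w = M}"
  have sep: "dyn_dist f N (z u) (z v) \<ge> \<epsilon>" if uv: "u \<in> ?W" "v \<in> ?W" "u \<noteq> v" for u v
  proof -
    obtain i where i: "i < M" "u ! i \<noteq> v ! i" using uv by (auto simp: list_eq_iff_nth_eq)
    define t where "t = 1 + i * (2 * \<tau> + 2) + \<tau>"
    have "Suc i * (2 * \<tau> + 2) \<le> M * (2 * \<tau> + 2)" using i(1) by (intro mult_le_mono1) simp
    then have "t < N" by (simp add: t_def N)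
    have "dist (if u ! i then q ((f ^^ t) x) else (f ^^ t) x) ((f ^^ t) (z u)) < \<epsilon>"
      "dist (if v ! i then q ((f ^^ t) x) else (f ^^ t) x) ((f ^^ t) (z v)) < \<epsilon>"
      using shadows_itinerary_at_visit[OF z _ t_def] uv i(1) by auto
    then have "dist ((f ^^ t) (z u)) ((f ^^ t) (z v)) \<ge> \<epsilon>"
      using i(2) q[of "(f ^^ t) x"]
        dist_triangle[of "(f ^^ t) x" "q ((f ^^ t) x)" "(f ^^ t) (z u)"]
        dist_triangle[of "(f ^^ t) x" "q ((f ^^ t) x)" "(f ^^ t) (z v)"]
        dist_triangle[of "(f ^^ t) (z v)" "q ((f ^^ t) x)" "(f ^^ t) (z u)"]
        dist_triangle[of "(f ^^ t) (z u)" "q ((f ^^ t) x)" "(f ^^ t) (z v)"]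
      by (cases "u ! i"; cases "v ! i") (simp_all add: dist_commute)
    also have "\<dots> \<le> dyn_dist f N (z u) (z v)" by (rule dist_le_dyn_dist) fact
    finally show ?thesis .
  qed
  have inj: "inj_on z ?W"
  proof (rule inj_onI, rule ccontr)
    fix u v assume uv: "u \<in> ?W" "v \<in> ?W" "z u = z v" "u \<noteq> v"
    have "dyn_dist f N (z u) (z v) < \<epsilon>"
      using uv(3) eps(1) by (subst dyn_dist_less_iff) (simp_all add: N)
    with sep[OF uv(1,2,4)] show False by simp
  qed
  have "dyn_separated f N \<epsilon> (z ` ?W)"
    unfolding dyn_separated_def using sep by blast
  then have ps: "(\<Sum>y\<in>z ` ?W. exp (birkhoff_sum f \<phi> N y)) \<le> partition_sum f \<phi> \<epsilon> N"
    using N by (intro partition_sum_ge[OF X f \<phi> eps(1)]) simp_all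
  have "exp (birkhoff_sum f \<phi> N x - V) * (1 + exp (- c)) ^ M
      = (\<Sum>w\<in>?W. exp (birkhoff_sum f \<phi> N x - V) * exp (- real (count_list w True) * c))"
    by (simp only: sum_exp_count_words[symmetric] sum_distrib_left)
  also have "\<dots> \<le> (\<Sum>w\<in>?W. exp (birkhoff_sum f \<phi> N (z w)))"
  proof (rule sum_mono)
    fix w assume "w \<in> ?W"
    then have "birkhoff_sum f \<phi> N x - V - real (count_list w True) * c \<le> birkhoff_sum f \<phi> N (z w)"
      unfolding c by (intro birkhoff_sum_itinerary_ge[OF bowen D z]) (simp_all add: N)
    then show "exp (birkhoff_sum f \<phi> N x - V) * exp (- real (count_list w True) * c)
        \<le> exp (birkhoff_sum f \<phi> N (z w))"
      by (simp add: exp_add[symmetric])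
  qed
  also have "\<dots> = (\<Sum>y\<in>z ` ?W. exp (birkhoff_sum f \<phi> N y))" by (simp add: sum.reindex[OF inj])
  finally show ?thesis using ps by simp
qed

lemma pressure_at_ge_integral_plus:
  fixes f :: "'a::metric_space \<Rightarrow> 'a"
  assumes X: "compact (UNIV :: 'a set)" and f: "continuous_on UNIV f" and \<phi>: "continuous_on UNIV \<phi>"
    and eps: "0 < \<epsilon>" "\<epsilon> < 1 / 6 * diameter (UNIV :: 'a set)"
    and spec: "specification_at f \<epsilon> \<tau>" and bowen: "bowen_property_at f \<phi> \<epsilon> V"
    and D: "\<And>x y. \<phi> x - \<phi> y \<le> D"
    and c: "c = V + (2 * real \<tau> + 1) * D" and inv: "invariant_prob f \<mu>"
  shows "ereal (integral\<^sup>L \<mu> \<phi> + ln (1 + exp (- c)) / (2 * (real \<tau> + 1))) \<le> pressure_at f \<phi> \<epsilon>"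
proof -
  define a where "a = integral\<^sup>L \<mu> \<phi>"
  define l where "l = ln (1 + exp (- c))"
  define r :: "nat \<Rightarrow> nat" where "r M = 1 + M * (2 * \<tau> + 2)" for M
  define b where "b M = a - V / real (r M) + l * (real M / real (r M))" for M
  have b_le: "b M \<le> ln (partition_sum f \<phi> \<epsilon> (r M)) / real (r M)" for M
  proof -
    obtain x where x: "birkhoff_sum f \<phi> (r M) x \<ge> real (r M) * a"
      unfolding a_def using ex_birkhoff_sum_ge_integral[OF X f \<phi> inv] by blast
    have pos: "1 + exp (- c) > 0" by (simp add: add_pos_pos)
    have "exp (real (r M) * a - V) * (1 + exp (- c)) ^ M
        \<le> exp (birkhoff_sum f \<phi> (r M) x - V) * (1 + exp (- c)) ^ M"
      using x pos by (intro mult_right_mono) simp_all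
    also have "\<dots> \<le> partition_sum f \<phi> \<epsilon> (r M)"
      by (rule partition_sum_ge_excursions[OF X f \<phi> eps spec bowen D c r_def])
    finally have "ln (exp (real (r M) * a - V) * (1 + exp (- c)) ^ M)
        \<le> ln (partition_sum f \<phi> \<epsilon> (r M))"
      using pos by (intro ln_mono) simp_all
    moreover have "ln (exp (real (r M) * a - V) * (1 + exp (- c)) ^ M)
        = real (r M) * a - V + real M * l"
      using pos by (simp add: ln_mult ln_realpow l_def)
    ultimately have "real (r M) * a - V + real M * l \<le> ln (partition_sum f \<phi> \<epsilon> (r M))" by simp
    moreover have "real (r M) > 0" unfolding of_nat_0_less_iff by (simp add: r_def)
    then have "b M = (real (r M) * a - V + real M * l) / real (r M)"
      by (simp add: b_def field_simps)
    ultimately show ?thesis by (simp add: divide_right_mono)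
  qed
  have mono: "strict_mono r"
    unfolding strict_mono_def r_def
    by (intro allI impI add_strict_left_mono mult_strict_right_mono) simp_all
  have r_inv: "(\<lambda>M. inverse (real (r M))) \<longlonglongrightarrow> 0"
    using LIMSEQ_subseq_LIMSEQ[OF lim_inverse_n mono] by (simp add: o_def)
  have ratio: "real M / real (r M) = (1 - inverse (real (r M))) / (2 * (real \<tau> + 1))" for M
  proof -
    have "real M * (2 * (real \<tau> + 1)) = real (r M) - 1" by (simp add: r_def algebra_simps)
    moreover have "real (r M) > 0" unfolding of_nat_0_less_iff by (simp add: r_def)
    ultimately show ?thesis by (simp add: divide_simps)
  qed
  have "b \<longlonglongrightarrow> a - V * 0 + l * ((1 - 0) / (2 * (real \<tau> + 1)))"
    unfolding b_def[abs_def] ratio divide_inverse[of V]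
    by (intro tendsto_intros r_inv) simp
  then have "(\<lambda>M. ereal (b M)) \<longlonglongrightarrow> ereal (a + l / (2 * (real \<tau> + 1)))" by simp
  then have "ereal (a + l / (2 * (real \<tau> + 1))) = limsup (\<lambda>M. ereal (b M))"
    by (rule lim_imp_Limsup[OF trivial_limit_sequentially, symmetric])
  also have "\<dots> \<le> limsup ((\<lambda>n. ereal (ln (partition_sum f \<phi> \<epsilon> n) / real n)) \<circ> r)"
    by (rule Limsup_mono) (simp add: b_le)
  also have "\<dots> \<le> pressure_at f \<phi> \<epsilon>"
    unfolding pressure_at_def by (rule limsup_subseq_mono[OF mono])
  finally show ?thesis by (simp add: a_def l_def)
qed

theorem theorem6p1:
  fixes f :: "'a::metric_space \<Rightarrow> 'a" and \<phi> :: "'a \<Rightarrow> real"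
    and \<epsilon> V \<Delta> :: real and \<tau> :: nat
  assumes compact_X: "compact (UNIV :: 'a set)"
    and homeo: "\<exists>g. homeomorphism UNIV UNIV f g"
    and eps: "0 < \<epsilon>" "\<epsilon> < 1 / 6 * diameter (UNIV :: 'a set)"
    and spec: "specification_at f \<epsilon> \<tau>"
    and cont: "continuous_on UNIV \<phi>"
    and bowen: "bowen_property_at f \<phi> \<epsilon> V"
    and Delta: "\<Delta> = ln (1 + exp (- (V + (2 * real \<tau> + 1) * ((SUP x. \<phi> x) - (INF x. \<phi> x)))))
                      / (2 * (real \<tau> + 1))"
  shows "pressure f \<phi> \<ge> pressure_at f \<phi> \<epsilon>
    \<and> pressure_at f \<phi> \<epsilon> \<ge> (SUP \<mu>\<in>{\<mu>. invariant_prob f \<mu>}. ereal (integral\<^sup>L \<mu> \<phi>)) + ereal \<Delta>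
    \<and> (\<forall>\<mu>. equilibrium_state f \<phi> \<mu> \<longrightarrow> metric_entropy \<mu> f \<ge> ereal \<Delta>)
    \<and> \<Delta> > 0"
proof -
  have f: "continuous_on UNIV f" using homeo by (auto simp: homeomorphism_def)
  have bdd: "bounded (range \<phi>)"
    by (rule compact_imp_bounded[OF compact_continuous_image[OF cont compact_X]])
  have osc: "\<phi> x - \<phi> y \<le> (SUP x. \<phi> x) - (INF x. \<phi> x)" for x y
    using cSUP_upper[OF UNIV_I bounded_imp_bdd_above[OF bdd], of x]
      cINF_lower[OF bounded_imp_bdd_below[OF bdd] UNIV_I, of y] by simp
  have gap: "ereal (integral\<^sup>L \<mu> \<phi> + \<Delta>) \<le> pressure_at f \<phi> \<epsilon>" if "invariant_prob f \<mu>" for \<mu>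
    unfolding Delta
    by (rule pressure_at_ge_integral_plus[OF compact_X f cont eps spec bowen osc refl that])
  have mono: "pressure_at f \<phi> \<epsilon> \<le> pressure f \<phi>"
    by (rule pressure_at_le_pressure[OF compact_X f cont eps(1)])
  have "(SUP \<mu>\<in>{\<mu>. invariant_prob f \<mu>}. ereal (integral\<^sup>L \<mu> \<phi>)) \<le> pressure_at f \<phi> \<epsilon> - ereal \<Delta>"
    using gap by (intro SUP_least) (simp add: ereal_le_minus)
  then have sup: "(SUP \<mu>\<in>{\<mu>. invariant_prob f \<mu>}. ereal (integral\<^sup>L \<mu> \<phi>)) + ereal \<Delta>
      \<le> pressure_at f \<phi> \<epsilon>"
    by (simp add: ereal_le_minus)
  have "metric_entropy \<mu> f \<ge> ereal \<Delta>" if "equilibrium_state f \<phi> \<mu>" for \<mu>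
  proof -
    have "ereal (integral\<^sup>L \<mu> \<phi> + \<Delta>) \<le> metric_entropy \<mu> f + ereal (integral\<^sup>L \<mu> \<phi>)"
      using that gap[of \<mu>] mono unfolding equilibrium_state_def by auto
    then show ?thesis by (cases "metric_entropy \<mu> f") auto
  qed
  moreover have "\<Delta> > 0"
    unfolding Delta by (intro divide_pos_pos ln_gt_zero) (simp_all add: add_pos_pos)
  ultimately show ?thesis using mono sup by blast
qed

end
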